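(* Consider the fourth-order (quartic) pencil ($D_z=d/dz$) $$\begin{aligned}\mathbf{F}^*_\lambda\psi^*\equiv\{&(\lambda^4+6\lambda^3+11\lambda^2+6\lambda)I+4(\lambda^3+6\lambda^2+11\lambda)zD_z\\&+2(1+3z^2)(\lambda^2+5\lambda)D_z^2+4\lambda(1+z^2)zD_z^3-\mathbf{C}^*\}\psi^*=0,\end{aligned}$$ where $\mathbf{C}^*\psi=-(1+z^2)^2D_z^4\psi-12z(1+z^2)D_z^3\psi-12(1+3z^2)D_z^2\psi-24zD_z\psi$. This pencil has four discrete spectra of real negative eigenvalues $$\lambda_{l,1}=-l\ (l=1,2,3,\dots),\quad\lambda_{l,2}=-l-1,\quad\lambda_{l,3}=-l-2,\quad\lambda_{l,4}=-l-3\ (l=0,1,2,3,\dots),$$ with the finite polynomial eigenfunctions given by $$\psi_l^*(z)=z^l+b_{l-2}z^{l-2}+b_{l-4}z^{l-4}+\cdots=\sum_{k=l,l-2,\dots}b_kz^k,\qquad b_l=1,$$ where the expansion coefficients satisfy the finite Kummer-type recursion corresponding to the operator $\mathbf{F}^*_\lambda$: for $k\ge4$ and any $i=1,2,3,4$, $$\begin{aligned}b_{k+4}=&-\frac{2\lambda_{l,i}(\lambda_{l,i}+5)+4\lambda_{l,i}k+2k(k-1)+12k+12}{(k+4)(k+3)}\,b_{k+2}\\&-\frac{\lambda_{l,i}[\lambda_{l,i}^3+6\lambda_{l,i}^2+11\lambda_{l,i}+6]+4\lambda_{l,i}[\lambda_{l,i}^2+6\lambda_{l,i}+11]+6\lambda_{l,i}(\lambda_{l,i}+5)k(k-1)}{(k+4)(k+3)(k+2)(k+1)}\,b_k\\&-\frac{4\lambda_{l,i}k(k-1)(k-2)+k(k-1)(k-2)(k-3)+12k(k-1)(k-2)+36k(k-1)+24k}{(k+4)(k+3)(k+2)(k+1)}\,b_k,\end{aligned}$$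 and $$\begin{aligned}&\lambda_{l,i}(\lambda_{l,i}^3+6\lambda_{l,i}^2+11\lambda_{l,i}+6)\,b_0+[4(\lambda_{l,i}^2+5\lambda_{l,i})+24]\,b_2+24\,b_4=0,\\&[\lambda_{l,i}^4+10\lambda_{l,i}^3+17\lambda_{l,i}^2+17\lambda_{l,i}+24]\,b_1+12[\lambda_{l,i}^2+7\lambda_{l,i}+12]\,b_3+120\,b_5=0,\\&[\lambda_{l,i}^4+10\lambda_{l,i}^3+47\lambda_{l,i}^2+110\lambda_{l,i}+120]\,b_2+24[\lambda_{l,i}^2+9\lambda_{l,i}+20]\,b_4+360\,b_6=0,\\&[\lambda_{l,i}^4+10\lambda_{l,i}^3+71\lambda_{l,i}^2+254\lambda_{l,i}+460]\,b_3+240[\lambda_{l,i}+5]\,b_5+840\,b_7=0.\end{aligned}$$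
   Context: Here $z\in\mathbb{R}$. An eigenvalue of the pencil is a number $\lambda$ for which $\mathbf{F}^*_\lambda\psi^*=0$ has a nontrivial admissible solution $\psi^*$ (eigenfunction); the admissible eigenfunctions are finite polynomials in $z$. The pencil arises from the bi-Laplace equation $\Delta^2u=0$ in the plane by setting $u(x,y)=e^{\lambda\tau}\psi^*(z)$ with $z=x/(-y)$, $\tau=-\ln(-y)$, $y<0$, and $\mathrm{Re}\,\lambda<0$.
   Formalization: Misprints in the recursion are corrected to match F*_λ: the term 4λ[λ²+6λ+11] gets the factor k, and the coefficients of b_1, b_2, b_3 (leading terms) and of b_5 in the last relation are replaced; as printed they fail, e.g. for ψ*=z, λ=-1. *)

theory Defs
  imports "HOL-Analysis.Analysis" "HOL-Computational_Algebra.Polynomial"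
begin

definition Dz :: "(real \<Rightarrow> complex) \<Rightarrow> real \<Rightarrow> complex" where
  "Dz \<psi> = (\<lambda>z. vector_derivative \<psi> (at z))"

definition Cstar :: "(real \<Rightarrow> complex) \<Rightarrow> real \<Rightarrow> complex" where
  "Cstar \<psi> = (\<lambda>z.
     - (1 + (of_real z)\<^sup>2)\<^sup>2 * (Dz ^^ 4) \<psi> z
     - 12 * of_real z * (1 + (of_real z)\<^sup>2) * (Dz ^^ 3) \<psi> z
     - 12 * (1 + 3 * (of_real z)\<^sup>2) * (Dz ^^ 2) \<psi> z
     - 24 * of_real z * Dz \<psi> z)"

definition Fstar :: "complex \<Rightarrow> (real \<Rightarrow> complex) \<Rightarrow> real \<Rightarrow> complex" where
  "Fstar \<mu> \<psi> = (\<lambda>z.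
     (\<mu>^4 + 6 * \<mu>^3 + 11 * \<mu>^2 + 6 * \<mu>) * \<psi> z
     + 4 * (\<mu>^3 + 6 * \<mu>^2 + 11 * \<mu>) * of_real z * Dz \<psi> z
     + 2 * (1 + 3 * (of_real z)\<^sup>2) * (\<mu>^2 + 5 * \<mu>) * (Dz ^^ 2) \<psi> z
     + 4 * \<mu> * (1 + (of_real z)\<^sup>2) * of_real z * (Dz ^^ 3) \<psi> z
     - Cstar \<psi> z)"

definition admissible :: "(real \<Rightarrow> complex) \<Rightarrow> bool" where
  "admissible \<psi> \<longleftrightarrow> (\<exists>p :: complex poly. \<forall>z. \<psi> z = poly p (of_real z))"

definition eigenfunction :: "complex \<Rightarrow> (real \<Rightarrow> complex) \<Rightarrow> bool" where
  "eigenfunction \<mu> \<psi> \<longleftrightarrow>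
     admissible \<psi> \<and> (\<exists>z. \<psi> z \<noteq> 0) \<and> (\<forall>z. Fstar \<mu> \<psi> z = 0)"

text \<open>The pencil is considered in the half-plane \<open>Re \<mu> < 0\<close> only. Without this restriction
  \<open>\<mu> = 0\<close> (with constant \<open>\<psi>\<close>) would be an eigenvalue as well.\<close>

definition eigenvalue :: "complex \<Rightarrow> bool" where
  "eigenvalue \<mu> \<longleftrightarrow> Re \<mu> < 0 \<and> (\<exists>\<psi>. eigenfunction \<mu> \<psi>)"

text \<open>\<open>lam l i\<close> is \<open>\<lambda>\<^sub>l\<^sub>,\<^sub>i\<close>, that is \<open>-l, -l-1, -l-2, -l-3\<close> for \<open>i = 1, 2, 3, 4\<close>;
  the first family starts at \<open>l = 1\<close>, the others at \<open>l = 0\<close>.\<close>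

definition lam :: "nat \<Rightarrow> nat \<Rightarrow> complex" where
  "lam l i = - of_nat l - (of_nat i - 1)"

definition lrange :: "nat \<Rightarrow> nat set" where
  "lrange i = (if i = 1 then {1..} else UNIV)"

definition spec :: "nat \<Rightarrow> complex set" where
  "spec i = (\<lambda>l. lam l i) ` lrange i"

text \<open>Coefficients are extended by zero to all of \<open>nat\<close>, so that the recursion below
  makes sense for every \<open>k\<close>.\<close>

definition expansion :: "nat \<Rightarrow> (nat \<Rightarrow> complex) \<Rightarrow> bool" where
  "expansion l b \<longleftrightarrow> b l = 1 \<and> (\<forall>k. \<not> (k \<le> l \<and> even (l - k)) \<longrightarrow> b k = 0)"

definition psi :: "nat \<Rightarrow> (nat \<Rightarrow> complex) \<Rightarrow> real \<Rightarrow> complex" where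
  "psi l b = (\<lambda>z. \<Sum>k | k \<le> l \<and> even (l - k). b k * of_real z ^ k)"

text \<open>The coefficient of \<open>z^k\<close> in \<open>Fstar \<mu> (psi l b)\<close>, solved for \<open>b (k+4)\<close> when \<open>k \<ge> 4\<close> and
  written out for \<open>k = 0, 1, 2, 3\<close>. The coefficient of \<open>b k\<close> is
  \<open>(\<mu>+k)(\<mu>+k+1)(\<mu>+k+2)(\<mu>+k+3)\<close> and that of \<open>b (k+2)\<close> is
  \<open>2(k+2)(k+1)(\<mu>+k+2)(\<mu>+k+3)\<close>.
  The source drops the factor \<open>k\<close> of \<open>4\<mu>(\<mu>^2+6\<mu>+11)\<close> in the general step and misprints
  the coefficients of \<open>b 1\<close>, \<open>b 2\<close>, \<open>b 3\<close> (leading terms of the last three initial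
  relations) and of \<open>b 5\<close> in the last one; the values determined by the operator are
  used here. As printed, the second relation already fails for \<open>\<psi> z = z\<close>, \<open>\<mu> = -1\<close>.\<close>

definition recursion :: "complex \<Rightarrow> (nat \<Rightarrow> complex) \<Rightarrow> bool" where
  "recursion \<mu> b \<longleftrightarrow>
     (\<forall>n\<ge>4. let k = of_nat n :: complex in
        b (n + 4) =
          - (2 * \<mu> * (\<mu> + 5) + 4 * \<mu> * k + 2 * k * (k - 1) + 12 * k + 12)
              / ((k + 4) * (k + 3)) * b (n + 2)
          - (\<mu> * (\<mu>^3 + 6 * \<mu>^2 + 11 * \<mu> + 6) + 4 * \<mu> * (\<mu>^2 + 6 * \<mu> + 11) * k
               + 6 * \<mu> * (\<mu> + 5) * k * (k - 1))
              / ((k + 4) * (k + 3) * (k + 2) * (k + 1)) * b n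
          - (4 * \<mu> * k * (k - 1) * (k - 2) + k * (k - 1) * (k - 2) * (k - 3)
               + 12 * k * (k - 1) * (k - 2) + 36 * k * (k - 1) + 24 * k)
              / ((k + 4) * (k + 3) * (k + 2) * (k + 1)) * b n) \<and>
     \<mu> * (\<mu>^3 + 6 * \<mu>^2 + 11 * \<mu> + 6) * b 0
       + (4 * (\<mu>^2 + 5 * \<mu>) + 24) * b 2 + 24 * b 4 = 0 \<and>
     (\<mu>^4 + 10 * \<mu>^3 + 35 * \<mu>^2 + 50 * \<mu> + 24) * b 1
       + 12 * (\<mu>^2 + 7 * \<mu> + 12) * b 3 + 120 * b 5 = 0 \<and>
     (\<mu>^4 + 14 * \<mu>^3 + 71 * \<mu>^2 + 154 * \<mu> + 120) * b 2
       + 24 * (\<mu>^2 + 9 * \<mu> + 20) * b 4 + 360 * b 6 = 0 \<and>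
     (\<mu>^4 + 18 * \<mu>^3 + 119 * \<mu>^2 + 342 * \<mu> + 360) * b 3
       + 40 * (\<mu>^2 + 11 * \<mu> + 30) * b 5 + 840 * b 7 = 0"

text \<open>The pairs \<open>(l, i)\<close> with \<open>\<lambda>\<^sub>l\<^sub>,\<^sub>i = \<mu>\<close>. The four families overlap, so an eigenvalue
  may have several (at most four).\<close>

definition indices :: "complex \<Rightarrow> (nat \<times> nat) set" where
  "indices \<mu> = {(l, i). i \<in> {1..4} \<and> l \<in> lrange i \<and> lam l i = \<mu>}"

end

theory Submission
  imports Defs
begin

text \<open>
  Everything rests on one fact: on polynomials the pencil acts on coefficients by a three-term
  relation whose factors are linear in \<open>\<mu>\<close>. The coefficient of \<open>z\<^sup>n\<close> in
  \<open>Fstar \<mu> (\<Sum>k. b\<^sub>k z\<^sup>k)\<close> is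
  \<open>(\<mu>+n)(\<mu>+n+1)(\<mu>+n+2)(\<mu>+n+3) b\<^sub>n + 2(n+1)(n+2)(\<mu>+n+2)(\<mu>+n+3) b\<^sub>n\<^sub>+\<^sub>2
  + (n+1)(n+2)(n+3)(n+4) b\<^sub>n\<^sub>+\<^sub>4\<close>.
  The factorisation comes from the bi-Laplacian. Put \<open>t = -y\<close>; the term \<open>b\<^sub>k z\<^sup>k\<close> then
  corresponds to \<open>u = b\<^sub>k x\<^sup>k t\<^bsup>-\<mu>-k\<^esup>\<close>, and the three terms above are produced by the
  fourth \<open>t\<close>-derivative, by twice the mixed derivative of order \<open>(2,2)\<close> and by the fourth
  \<open>x\<close>-derivative (\<open>pencil_coeff\<close>, \<open>coeff_pencil_poly\<close>).

  Being a polynomial eigenfunction therefore means that the coefficient sequence is annihilated by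
  this relation, which is the Kummer-type recursion after division by the nonzero coefficient of
  \<open>b\<^sub>n\<^sub>+\<^sub>4\<close> (\<open>recursion_iff\<close>). Three consequences give the theorem.

  \<^item> In degree \<open>l\<close> only the first term survives at \<open>n = l\<close>, so that
    \<open>(\<mu>+l)(\<mu>+l+1)(\<mu>+l+2)(\<mu>+l+3) = 0\<close> and \<open>\<mu>\<close> is one of
    \<open>-l, -l-1, -l-2, -l-3\<close> (\<open>leading_exponent\<close>).

  \<^item> Conversely, for such \<open>\<mu>\<close> the relation is solved downwards from \<open>b\<^sub>l = 1\<close>. Among the
    indices \<open>l-2, l-4, \<dots>\<close> the factor of \<open>b\<^sub>n\<close> can vanish at \<open>n = l-2\<close> only, for
    \<open>\<mu> = -l\<close> or \<open>\<mu> = -l-1\<close>; there the factor of \<open>b\<^sub>n\<^sub>+\<^sub>2\<close> vanishes as well, the relation is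
    void and \<open>b\<^sub>l\<^sub>-\<^sub>2\<close> is free (\<open>pencil_coeff_descend\<close>).

  \<^item> Given any polynomial eigenfunction, subtracting a multiple of the eigenfunction with the same
    leading exponent lowers the degree; iteration expresses it in the constructed eigenfunctions
    (\<open>kernel_spanned\<close>).
\<close>

section \<open>The pencil on polynomials\<close>

definition pencil_coeff :: "complex \<Rightarrow> (nat \<Rightarrow> complex) \<Rightarrow> nat \<Rightarrow> complex" where
  "pencil_coeff \<mu> b n = (let k = of_nat n in
     (\<mu> + k) * (\<mu> + k + 1) * (\<mu> + k + 2) * (\<mu> + k + 3) * b n
     + 2 * (k + 2) * (k + 1) * (\<mu> + k + 2) * (\<mu> + k + 3) * b (n + 2)
     + (k + 4) * (k + 3) * (k + 2) * (k + 1) * b (n + 4))"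

text \<open>The pencil with its variable coefficients expanded into powers of \<open>z\<close>. Products of the form
  \<open>monom 1 j * (pderiv ^^ i) p\<close> make every summand an index shift combined with a Pochhammer
  factor, so that coefficients can be read off.\<close>

definition pencil_poly :: "complex \<Rightarrow> complex poly \<Rightarrow> complex poly" where
  "pencil_poly \<mu> p =
     smult (\<mu>^4 + 6 * \<mu>^3 + 11 * \<mu>^2 + 6 * \<mu>) p
     + smult (4 * (\<mu>^3 + 6 * \<mu>^2 + 11 * \<mu>) + 24) (monom 1 1 * (pderiv ^^ 1) p)
     + smult (2 * (\<mu>^2 + 5 * \<mu>) + 12) ((pderiv ^^ 2) p)
     + smult (6 * (\<mu>^2 + 5 * \<mu>) + 36) (monom 1 2 * (pderiv ^^ 2) p)
     + smult (4 * \<mu> + 12) (monom 1 1 * (pderiv ^^ 3) p)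
     + smult (4 * \<mu> + 12) (monom 1 3 * (pderiv ^^ 3) p)
     + (pderiv ^^ 4) p + smult 2 (monom 1 2 * (pderiv ^^ 4) p) + monom 1 4 * (pderiv ^^ 4) p"

lemma Dz_poly: "Dz (\<lambda>z. poly p (of_real z)) = (\<lambda>z. poly (pderiv p) (of_real z))"
  unfolding Dz_def
  by (rule ext, rule vector_derivative_at, rule has_vector_derivative_real_field)
     (rule poly_DERIV)

lemma Dz_funpow_poly:
  "(Dz ^^ n) (\<lambda>z. poly p (of_real z)) = (\<lambda>z. poly ((pderiv ^^ n) p) (of_real z))"
  by (induction n) (simp_all add: Dz_poly)

lemma Fstar_poly:
  "Fstar \<mu> (\<lambda>z. poly p (of_real z)) z = poly (pencil_poly \<mu> p) (of_real z)"
  using Dz_funpow_poly[of 1 p]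
  unfolding Fstar_def Cstar_def pencil_poly_def
  by (simp add: Dz_funpow_poly poly_monom) (simp add: algebra_simps power_numeral_reduce)

lemma coeff_pencil_poly: "coeff (pencil_poly \<mu> p) n = pencil_coeff \<mu> (coeff p) n"
proof -
  have cases: "n = 0 \<or> n = 1 \<or> n = 2 \<or> n = 3 \<or> (\<exists>m. n = m + 4)"
    by presburger
  have eq: "coeff (monom 1 j * (pderiv ^^ i) p) n
      = (if n < j then 0 else pochhammer (of_nat (Suc (n - j))) i * coeff p (n - j + i))" for i j
    by (simp add: coeff_monom_mult coeff_higher_pderiv)
  from cases show ?thesis
    \<comment> \<open>For \<open>n < 4\<close> some of the shifted summands are absent; for \<open>n = m + 4\<close> all shifts are honest
      and the claim is a polynomial identity in \<open>\<mu>\<close> and \<open>m\<close>.\<close>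
    unfolding pencil_poly_def pencil_coeff_def Let_def
    apply (simp only: coeff_add coeff_smult eq coeff_higher_pderiv)
    apply (elim disjE exE)
    apply (simp_all add: pochhammer_Suc numeral_eq_Suc)
    apply (simp_all add: algebra_simps)
    done
qed

text \<open>The differential equation is posed for real \<open>z\<close>, which is enough to identify complex
  polynomials since the real line is infinite.\<close>

lemma poly_of_real_eq_0_iff: "(\<forall>z::real. poly p (of_real z :: complex) = 0) \<longleftrightarrow> p = 0"
proof
  assume *: "\<forall>z::real. poly p (of_real z :: complex) = 0"
  have "range (of_real :: real \<Rightarrow> complex) \<subseteq> {x. poly p x = 0}"
    using * by auto
  moreover have "infinite (range (of_real :: real \<Rightarrow> complex))"
    by (simp add: finite_image_iff inj_of_real infinite_UNIV_char_0)
  ultimately have "infinite {x. poly p x = 0}"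
    using finite_subset by blast
  thus "p = 0" using poly_roots_finite by blast
qed auto

lemma eigenfunction_poly_iff:
  "eigenfunction \<mu> (\<lambda>z. poly p (of_real z)) \<longleftrightarrow> p \<noteq> 0 \<and> (\<forall>n. pencil_coeff \<mu> (coeff p) n = 0)"
  using poly_of_real_eq_0_iff[of p] poly_of_real_eq_0_iff[of "pencil_poly \<mu> p"]
  unfolding eigenfunction_def admissible_def Fstar_poly
  by (auto simp: poly_eq_iff coeff_pencil_poly)

text \<open>The displayed recursion and the four initial relations are the equations
  \<open>pencil_coeff \<mu> b n = 0\<close> for \<open>n \<ge> 4\<close> and for \<open>n = 0, 1, 2, 3\<close>, the former solved for
  \<open>b (n + 4)\<close>. This is legitimate because the coefficient of \<open>b (n + 4)\<close> never vanishes.\<close>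

lemma recursion_iff: "recursion \<mu> b \<longleftrightarrow> (\<forall>n. pencil_coeff \<mu> b n = 0)"
proof -
  have split: "(\<forall>n. P n) \<longleftrightarrow> (\<forall>n\<ge>4. P n) \<and> P 0 \<and> P 1 \<and> P 2 \<and> P (3::nat)" for P
  proof -
    have "n \<ge> 4 \<or> n = 0 \<or> n = 1 \<or> n = 2 \<or> n = (3::nat)" for n by presburger
    thus ?thesis by metis
  qed
  have solve: "x = - B / (p * q) * y - C / (p * q * r * s) * w - D / (p * q * r * s) * w
      \<longleftrightarrow> (C + D) * w + r * s * B * y + p * q * r * s * x = 0"
    if "p \<noteq> 0" "q \<noteq> 0" "r \<noteq> 0" "s \<noteq> 0" for x y w B C D p q r s :: complex
  proof -
    let ?d = "p * q * r * s"
    have d: "?d \<noteq> 0" using that by simp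
    have "?d * (- B / (p * q) * y - C / ?d * w - D / ?d * w) = - ((C + D) * w + r * s * B * y)"
      using that by (simp add: field_simps)
    hence "?d * x = - ((C + D) * w + r * s * B * y)
        \<longleftrightarrow> x = - B / (p * q) * y - C / ?d * w - D / ?d * w"
      using d by (metis mult_left_cancel)
    thus ?thesis by (simp only: eq_neg_iff_add_eq_0 add.commute[of _ "p * q * r * s * x"])
  qed
  have nz: "of_nat n + numeral m \<noteq> (0::complex)" "of_nat n + 1 \<noteq> (0::complex)" for n m
    using of_nat_neq_0[of n] by (metis of_nat_add of_nat_numeral of_nat_eq_0_iff add_is_0 zero_neq_numeral)
      (metis of_nat_Suc of_nat_neq_0 add.commute)
  show ?thesis
    unfolding recursion_def split[of "\<lambda>n. pencil_coeff \<mu> b n = 0"] Let_def solve[OF nz(1) nz(1) nz(1) nz(2)]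
    unfolding pencil_coeff_def Let_def
    apply (intro arg_cong2[where f = "(\<and>)"] all_cong arg_cong[where f = "\<lambda>x. x = 0"])
    apply (simp_all add: algebra_simps power_numeral_reduce flip: numeral_2_eq_2 numeral_3_eq_3)
    done
qed

section \<open>Solving the recursion downwards\<close>

definition psi_poly :: "nat \<Rightarrow> (nat \<Rightarrow> complex) \<Rightarrow> complex poly" where
  "psi_poly l b = (\<Sum>k | k \<le> l \<and> even (l - k). monom (b k) k)"

lemma psi_eq_poly: "psi l b = (\<lambda>z. poly (psi_poly l b) (of_real z))"
  by (simp add: psi_def psi_poly_def poly_sum poly_monom)

lemma coeff_psi_poly: "expansion l b \<Longrightarrow> coeff (psi_poly l b) = b"
  by (auto simp: psi_poly_def coeff_sum expansion_def fun_eq_iff)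

lemma eigenfunction_psi_iff:
  assumes "expansion l b"
  shows "eigenfunction \<mu> (psi l b) \<longleftrightarrow> (\<forall>n. pencil_coeff \<mu> b n = 0)"
proof -
  have "coeff (psi_poly l b) l = 1"
    using assms by (simp add: coeff_psi_poly expansion_def)
  hence "psi_poly l b \<noteq> 0" by auto
  thus ?thesis by (simp add: psi_eq_poly eigenfunction_poly_iff coeff_psi_poly assms)
qed

text \<open>The relation \<open>pencil_coeff \<mu> b n = 0\<close> solved for \<open>b n\<close>, starting from \<open>b l = 1\<close> and zeros above.
  Where the divisor vanishes, division by zero yields the value 0; this is the choice made for
  the coefficient that the relation leaves free.\<close>

function descend :: "complex \<Rightarrow> nat \<Rightarrow> nat \<Rightarrow> complex" where
  "descend \<mu> l n = (if n = l then 1 else if l < n then 0 else let k = of_nat n in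
     - (2 * (k + 2) * (k + 1) * (\<mu> + k + 2) * (\<mu> + k + 3) * descend \<mu> l (n + 2)
        + (k + 4) * (k + 3) * (k + 2) * (k + 1) * descend \<mu> l (n + 4))
     / ((\<mu> + k) * (\<mu> + k + 1) * (\<mu> + k + 2) * (\<mu> + k + 3)))"
  by auto
termination by (relation "Wellfounded.measure (\<lambda>(\<mu>, l, n). l - n)") auto

declare descend.simps [simp del]

lemma descend_same [simp]: "descend \<mu> l l = 1"
  by (simp add: descend.simps)

lemma descend_above: "l < n \<Longrightarrow> descend \<mu> l n = 0"
  by (simp add: descend.simps)

lemma descend_odd: "odd (l + n) \<Longrightarrow> descend \<mu> l n = 0"
proof (induction \<mu> l n rule: descend.induct)
  case (1 \<mu> l n)
  have "descend \<mu> l (n + 2) = 0" "descend \<mu> l (n + 4) = 0" if "n < l"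
    using 1 that by auto
  thus ?case using "1.prems" by (subst descend.simps) (auto simp: Let_def)
qed

lemma expansion_descend: "expansion l (descend \<mu> l)"
  unfolding expansion_def using descend_above descend_odd by (auto simp: not_le)

text \<open>The downward solution can only fail where the factor \<open>A\<close> of \<open>b n\<close> vanishes, that is, for
  \<open>n \<in> {m - 3..m}\<close> with \<open>\<mu> = -m\<close>, \<open>m = l + i - 1\<close>. At \<open>n = l\<close> this is what makes the leading
  coefficient arbitrary. Below \<open>l\<close> in the right parity only \<open>n = l - 2\<close> remains, with
  \<open>i \<in> {1, 2}\<close>; then one of \<open>\<mu> + n + 2\<close> and \<open>\<mu> + n + 3\<close> is zero and the remainder \<open>R\<close> vanishes too,
  because \<open>b (n + 4) = b (l + 2) = 0\<close>.\<close>

lemma pencil_coeff_descend: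
  assumes i: "i \<in> {1..4}" and \<mu>: "\<mu> = lam l i"
  shows "pencil_coeff \<mu> (descend \<mu> l) n = 0"
proof -
  define k :: complex where "k = of_nat n"
  define A where "A = (\<mu> + k) * (\<mu> + k + 1) * (\<mu> + k + 2) * (\<mu> + k + 3)"
  define R where "R = 2 * (k + 2) * (k + 1) * (\<mu> + k + 2) * (\<mu> + k + 3) * descend \<mu> l (n + 2)
        + (k + 4) * (k + 3) * (k + 2) * (k + 1) * descend \<mu> l (n + 4)"
  have pc: "pencil_coeff \<mu> (descend \<mu> l) n = A * descend \<mu> l n + R"
    by (simp add: pencil_coeff_def A_def R_def k_def Let_def)
  have shift: "\<mu> + k + of_nat s = of_int (int n - int l - int i + 1 + int s)" for s
    by (simp add: \<mu> k_def lam_def)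
  have zero: "\<mu> + k + of_nat s = 0 \<longleftrightarrow> n + s + 1 = l + i" for s
    unfolding shift of_int_eq_0_iff by linarith
  have A0: "A = 0 \<longleftrightarrow> n + 1 = l + i \<or> n + 2 = l + i \<or> n + 3 = l + i \<or> n + 4 = l + i"
    using zero[of 0] zero[of 1] zero[of 2] zero[of 3] by (simp add: A_def eval_nat_numeral)
  consider "n = l" | "n > l" | "n < l" "A \<noteq> 0" | "n < l" "A = 0" by linarith
  thus ?thesis
  proof cases
    case 1
    hence "A = 0" using A0 i by auto
    thus ?thesis unfolding pc using 1 by (simp add: R_def descend_above)
  next
    case 2
    thus ?thesis unfolding pc by (simp add: R_def descend_above)
  next
    case 3
    have "descend \<mu> l n = - R / A"
      using 3(1) by (subst descend.simps) (simp add: R_def A_def k_def Let_def)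
    thus ?thesis using 3(2) by (simp add: pc)
  next
    case 4
    show ?thesis
    proof (cases "even (l + n)")
      case True
      have "n + 1 \<noteq> l" "n + 3 \<noteq> l" using True by auto
      hence "n + 2 = l" "i = 1 \<or> i = 2" using 4 A0 i by auto
      hence "\<mu> + k + 2 = 0 \<or> \<mu> + k + 3 = 0" using zero[of 2] zero[of 3] by auto
      hence "R = 0" using \<open>n + 2 = l\<close> by (auto simp: R_def descend_above)
      thus ?thesis using 4 by (simp add: pc)
    next
      case False
      thus ?thesis unfolding pc by (simp add: R_def descend_odd)
    qed
  qed
qed

section \<open>All polynomial eigenfunctions\<close>

text \<open>At \<open>n = degree p\<close> the three-term relation reduces to its first term. The half-plane condition
  enters only to exclude \<open>\<mu> = 0\<close> in degree 0, the index missing from the first family.\<close>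

lemma leading_exponent:
  assumes "p \<noteq> 0" "pencil_coeff \<mu> (coeff p) (degree p) = 0" "Re \<mu> < 0"
  shows "\<exists>i. (degree p, i) \<in> indices \<mu>"
proof -
  define k :: complex where "k = of_nat (degree p)"
  have "(\<mu> + k) * (\<mu> + k + 1) * (\<mu> + k + 2) * (\<mu> + k + 3) = 0"
    using assms(1,2) by (simp add: pencil_coeff_def Let_def coeff_eq_0 k_def)
  moreover have "\<mu> = lam (degree p) (Suc s) \<longleftrightarrow> \<mu> + k + of_nat s = 0" for s
    by (simp add: lam_def k_def eq_diff_eq eq_neg_iff_add_eq_0 add_ac)
  note this[of 0] this[of 1] this[of 2] this[of 3]
  ultimately have "\<exists>i\<in>{1,2,3,4}. \<mu> = lam (degree p) i"
    by (auto simp: eval_nat_numeral)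
  hence "\<exists>i\<in>{1..4}. \<mu> = lam (degree p) i" by force
  then obtain i where i: "i \<in> {1..4}" "\<mu> = lam (degree p) i" ..
  have "degree p \<in> lrange i"
    using assms(3) i(2) by (auto simp: lrange_def lam_def Suc_le_eq)
  thus ?thesis using i by (auto simp: indices_def)
qed

lemma finite_indices: "finite (indices \<mu>)"
proof (rule finite_imageD)
  show "finite (snd ` indices \<mu>)"
    by (rule finite_subset[of _ "{1..4}"]) (auto simp: indices_def)
  show "inj_on snd (indices \<mu>)"
    by (auto simp: inj_on_def indices_def lam_def)
qed

lemma pencil_coeff_diff_smult:
  "pencil_coeff \<mu> (coeff (p - smult a q)) n
     = pencil_coeff \<mu> (coeff p) n - a * pencil_coeff \<mu> (coeff q) n"
  by (simp add: pencil_coeff_def Let_def algebra_simps)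

text \<open>Elimination from the top: the leading exponent of a kernel element always occurs in
  \<open>indices \<mu>\<close>, so the top coefficient can be removed by a constructed eigenfunction without
  leaving the kernel. The induction is on a strict bound for the exponents rather than on the
  degree, so that the zero polynomial is the base case.\<close>

lemma kernel_spanned:
  assumes "Re \<mu> < 0" "\<And>n. pencil_coeff \<mu> (coeff p) n = 0"
  shows "\<exists>c. p = (\<Sum>(l, i)\<in>indices \<mu>. smult (c l i) (psi_poly l (descend \<mu> l)))"
proof -
  have "\<exists>c. p = (\<Sum>(l, i)\<in>indices \<mu>. smult (c l i) (psi_poly l (descend \<mu> l)))"
    if "\<And>n. pencil_coeff \<mu> (coeff p) n = 0" "\<And>k. k \<ge> N \<Longrightarrow> coeff p k = 0" for N p
    using that
  proof (induction N arbitrary: p)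
    case 0
    hence "p = 0" by (auto simp: poly_eq_iff)
    thus ?case by (intro exI[of _ "\<lambda>_ _. 0"]) simp
  next
    case (Suc N)
    show ?case
    proof (cases "coeff p N = 0")
      case True
      hence "\<And>k. k \<ge> N \<Longrightarrow> coeff p k = 0"
        using Suc.prems(2) by (metis le_antisym not_less_eq_eq)
      thus ?thesis using Suc by blast
    next
      case False
      have "degree p \<le> N" using Suc.prems(2) by (intro degree_le) auto
      hence deg: "degree p = N" using False by (simp add: le_degree le_antisym)
      obtain i where i: "(N, i) \<in> indices \<mu>"
        using leading_exponent[of p \<mu>] False Suc.prems(1) assms(1) deg by auto
      let ?q = "psi_poly N (descend \<mu> N)"
      let ?p' = "p - smult (coeff p N) ?q"
      have q: "coeff ?q = descend \<mu> N" by (simp add: coeff_psi_poly expansion_descend)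
      have "pencil_coeff \<mu> (coeff ?p') n = 0" for n
        unfolding pencil_coeff_diff_smult q
        using i Suc.prems(1) by (auto simp: indices_def pencil_coeff_descend)
      moreover have "coeff ?p' k = 0" if "k \<ge> N" for k
        using that Suc.prems(2)[of k] by (cases "k = N") (auto simp: q descend_above)
      ultimately obtain c where
        c: "?p' = (\<Sum>(l, i)\<in>indices \<mu>. smult (c l i) (psi_poly l (descend \<mu> l)))"
        using Suc.IH by blast
      define d where "d = (\<lambda>l j. c l j + (if (l, j) = (N, i) then coeff p N else 0))"
      have "(\<Sum>(l, j)\<in>indices \<mu>. smult (d l j) (psi_poly l (descend \<mu> l)))
          = (\<Sum>(l, j)\<in>indices \<mu>. smult (c l j) (psi_poly l (descend \<mu> l)))
            + (\<Sum>x\<in>indices \<mu>. if x = (N, i) then smult (coeff p N) ?q else 0)"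
        unfolding sum.distrib[symmetric]
        by (rule sum.cong) (auto simp: d_def smult_add_left split: if_splits)
      also have "\<dots> = p"
        using i by (simp add: c[symmetric] finite_indices)
      finally show ?thesis by metis
    qed
  qed
  from this[of p "Suc (degree p)"] show ?thesis
    using assms(2) by (simp add: coeff_eq_0)
qed

lemma lam_negative: "l \<in> lrange i \<Longrightarrow> i \<in> {1..4} \<Longrightarrow> lam l i \<in> \<real> \<and> Re (lam l i) < 0"
  by (auto simp: lam_def lrange_def split: if_splits)

lemma spec_subset_Ints: "spec i \<subseteq> \<int>"
  by (auto simp: spec_def lam_def)

lemma eigenvalue_iff: "eigenvalue \<mu> \<longleftrightarrow> (\<exists>i\<in>{1..4}. \<mu> \<in> spec i)"
proof
  assume "eigenvalue \<mu>"
  then obtain \<psi> where "Re \<mu> < 0" "eigenfunction \<mu> \<psi>"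
    by (auto simp: eigenvalue_def)
  moreover from this obtain p where "\<psi> = (\<lambda>z. poly p (of_real z))"
    by (auto simp: eigenfunction_def admissible_def fun_eq_iff)
  ultimately have "Re \<mu> < 0" "eigenfunction \<mu> (\<lambda>z. poly p (of_real z))"
    by auto
  thus "\<exists>i\<in>{1..4}. \<mu> \<in> spec i"
    using leading_exponent[of p \<mu>] by (auto simp: eigenfunction_poly_iff indices_def spec_def)
next
  assume "\<exists>i\<in>{1..4}. \<mu> \<in> spec i"
  then obtain i l where "i \<in> {1..4}" "l \<in> lrange i" "\<mu> = lam l i"
    by (auto simp: spec_def)
  thus "eigenvalue \<mu>"
    unfolding eigenvalue_def
    using lam_negative eigenfunction_psi_iff[OF expansion_descend] pencil_coeff_descend by metis
qed

theorem theorem4p1: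
  "{\<mu>. eigenvalue \<mu>} = (\<Union>i\<in>{1..4}. spec i) \<and>
   (\<forall>i\<in>{1..4}. (\<forall>\<mu>\<in>spec i. \<mu> \<in> \<real> \<and> Re \<mu> < 0) \<and> (\<forall>x. \<not> x islimpt spec i)) \<and>
   (\<forall>i\<in>{1..4}. \<forall>l\<in>lrange i.
      (\<exists>b. expansion l b \<and> eigenfunction (lam l i) (psi l b)) \<and>
      (\<forall>b. expansion l b \<longrightarrow>
         (eigenfunction (lam l i) (psi l b) \<longleftrightarrow> recursion (lam l i) b))) \<and>
   (\<forall>\<mu> \<psi>. Re \<mu> < 0 \<and> eigenfunction \<mu> \<psi> \<longrightarrow>
      (\<exists>b c. (\<forall>(l, i)\<in>indices \<mu>. expansion l (b l i) \<and> eigenfunction \<mu> (psi l (b l i))) \<and>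
             (\<forall>z. \<psi> z = (\<Sum>(l, i)\<in>indices \<mu>. c l i * psi l (b l i) z))))"
proof (intro conjI ballI allI impI)
  show "{\<mu>. eigenvalue \<mu>} = (\<Union>i\<in>{1..4}. spec i)"
    by (auto simp: eigenvalue_iff)
next
  fix i \<mu> assume "i \<in> {1..4::nat}" "\<mu> \<in> spec i"
  thus "\<mu> \<in> \<real>" "Re \<mu> < 0"
    using lam_negative by (auto simp: spec_def)
next
  fix i x show "\<not> x islimpt spec i"
  proof (rule discrete_imp_not_islimpt)
    have "y = w" if "y \<in> \<int>" "w \<in> \<int>" "dist y w < 1" for y w :: complex
      using that by (auto elim!: Ints_cases simp: dist_norm simp flip: of_int_diff)
    thus "y = w" if "w \<in> spec i" "y \<in> spec i" "dist y w < 1" for w y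
      using that spec_subset_Ints by blast
  qed simp
next
  fix i l :: nat assume "i \<in> {1..4}"
  thus "\<exists>b. expansion l b \<and> eigenfunction (lam l i) (psi l b)"
    using expansion_descend eigenfunction_psi_iff pencil_coeff_descend by blast
next
  fix i l b assume "expansion l b"
  thus "eigenfunction (lam l i) (psi l b) \<longleftrightarrow> recursion (lam l i) b"
    by (simp add: eigenfunction_psi_iff recursion_iff)
next
  fix \<mu> \<psi> assume *: "Re \<mu> < 0 \<and> eigenfunction \<mu> \<psi>"
  then obtain p where p: "\<psi> = (\<lambda>z. poly p (of_real z))"
    by (auto simp: eigenfunction_def admissible_def fun_eq_iff)
  have "\<exists>c. p = (\<Sum>(l, i)\<in>indices \<mu>. smult (c l i) (psi_poly l (descend \<mu> l)))"
    using * kernel_spanned by (simp add: p eigenfunction_poly_iff)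
  then obtain c where
    c: "p = (\<Sum>(l, i)\<in>indices \<mu>. smult (c l i) (psi_poly l (descend \<mu> l)))" ..
  have "\<psi> z = (\<Sum>(l, i)\<in>indices \<mu>. c l i * psi l (descend \<mu> l) z)" for z
    by (subst p, subst c) (simp add: poly_sum psi_eq_poly case_prod_unfold)
  moreover have "eigenfunction \<mu> (psi l (descend \<mu> l))" if "(l, i) \<in> indices \<mu>" for l i
    using that eigenfunction_psi_iff[OF expansion_descend] pencil_coeff_descend
    by (auto simp: indices_def)
  ultimately show "\<exists>b c. (\<forall>(l, i)\<in>indices \<mu>. expansion l (b l i) \<and> eigenfunction \<mu> (psi l (b l i))) \<and>
             (\<forall>z. \<psi> z = (\<Sum>(l, i)\<in>indices \<mu>. c l i * psi l (b l i) z))"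
    by (intro exI[of _ "\<lambda>l _. descend \<mu> l"] exI[of _ c]) (auto simp: expansion_descend)
qed

end
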